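(* Let $p_1,p_2\in[0,1]$ with $p_1+p_2\le1$, let $r\ge2$ and $\pi\in\mathfrak{S}_r$. If $p_1<1$ and $\pi=\pi^{-1}$, then $\Sigma_{\pi,\pi}^{p_1,p_2}>0$, where, with $U,V,W$ i.i.d. uniform random variables on $[0,1]$, $$\begin{aligned}((r-1)!)^2\,\Sigma^{p_1,p_2}_{\pi,\pi}={}&p_1\,\mathrm{Var}[\psi_\pi^{p_1}(U,U)]+(1-p_1)\,\mathrm{Var}[\psi_\pi^{p_1}(U,V)]+p_2\,\mathrm{Cov}[\psi_\pi^{p_1}(U,V),\psi_\pi^{p_1}(V,U)]\\&+2(1-p_1-p_2)\,\mathrm{Cov}[\psi_\pi^{p_1}(U,V),\psi_\pi^{p_1}(V,W)].\end{aligned}$$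
   Context: $\mathfrak{S}_r$ is the set of permutations of $[r]=\{1,\dots,r\}$. For a set of $r$ points in the plane with pairwise distinct x-coordinates and pairwise distinct y-coordinates, $\mathrm{Perm}$ of this set is the permutation $\tau\in\mathfrak{S}_r$ such that $\tau(i)=j$ when the $i$-th point from the left is the $j$-th point from the bottom. Let $\hat Z_1,\dots,\hat Z_{r-1}$ be i.i.d. with law $p_1\mathrm{Leb}_\Delta+(1-p_1)\mathrm{Leb}_{[0,1]^2}$, where $\mathrm{Leb}_\Delta$ is the uniform probability measure on the diagonal of $[0,1]^2$ (the law of $(U,U)$ for $U$ uniform on $[0,1]$) and $\mathrm{Leb}_{[0,1]^2}$ is Lebesgue measure on $[0,1]^2$. For $z\in[0,1]^2$, $\psi_\pi^{p_1}(z):=\mathbf{P}(\mathrm{Perm}(\{\hat Z_1,\dots,\hat Z_{r-1},z\})=\pi)$. *)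

theory Defs
  imports "HOL-Probability.Probability" "HOL-Combinatorics.Permutations"
begin

definition generic :: "(real \<times> real) set \<Rightarrow> bool" where
  "generic S \<longleftrightarrow> finite S \<and> inj_on fst S \<and> inj_on snd S"

text \<open>A point \<open>p\<close> of \<open>S\<close> is the \<open>left_rank S p\<close>-th point from the left and the
  \<open>bottom_rank S p\<close>-th point from the bottom; ranks start at 1.\<close>

definition left_rank :: "(real \<times> real) set \<Rightarrow> real \<times> real \<Rightarrow> nat" where
  "left_rank S p = card {q \<in> S. fst q \<le> fst p}"

definition bottom_rank :: "(real \<times> real) set \<Rightarrow> real \<times> real \<Rightarrow> nat" where
  "bottom_rank S p = card {q \<in> S. snd q \<le> snd p}"

text \<open>Permutations of \<open>{1..r}\<close> are functions on \<^typ>\<open>nat\<close> that fix every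
  point outside \<open>{1..r}\<close>. The value is meaningful only for \<^const>\<open>generic\<close> sets.\<close>

definition Perm :: "(real \<times> real) set \<Rightarrow> nat \<Rightarrow> nat" where
  "Perm S = (THE \<tau>. \<tau> permutes {1..card S} \<and>
                   (\<forall>p\<in>S. \<tau> (left_rank S p) = bottom_rank S p))"

lemma bij_betw_rank:
  fixes f :: "'b \<Rightarrow> real"
  assumes "finite S" "inj_on f S"
  shows "bij_betw (\<lambda>p. card {q \<in> S. f q \<le> f p}) S {1..card S}"
proof -
  have less: "card {q \<in> S. f q \<le> f p} < card {q \<in> S. f q \<le> f p'}"
    if "p' \<in> S" "f p < f p'" for p p'
  proof (rule psubset_card_mono)
    show "{q \<in> S. f q \<le> f p} \<subset> {q \<in> S. f q \<le> f p'}"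
      using that by force
  qed (use assms in simp)
  have inj: "inj_on (\<lambda>p. card {q \<in> S. f q \<le> f p}) S"
  proof (rule inj_onI)
    fix x y assume "x \<in> S" "y \<in> S" "card {q \<in> S. f q \<le> f x} = card {q \<in> S. f q \<le> f y}"
    then have "f x = f y" using less[of x y] less[of y x] by linarith
    then show "x = y" using assms(2) \<open>x \<in> S\<close> \<open>y \<in> S\<close> by (auto dest: inj_onD)
  qed
  have "(\<lambda>p. card {q \<in> S. f q \<le> f p}) ` S \<subseteq> {1..card S}"
  proof
    fix k assume "k \<in> (\<lambda>p. card {q \<in> S. f q \<le> f p}) ` S"
    then obtain p where p: "p \<in> S" "k = card {q \<in> S. f q \<le> f p}" by blast
    have "k \<le> card S" unfolding p(2) by (rule card_mono) (use assms in auto)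
    moreover have "k \<noteq> 0" using p assms(1) by auto
    ultimately show "k \<in> {1..card S}" by simp
  qed
  then have "(\<lambda>p. card {q \<in> S. f q \<le> f p}) ` S = {1..card S}"
    by (rule card_subset_eq[rotated]) (simp_all add: card_image[OF inj])
  with inj show ?thesis by (simp add: bij_betw_def)
qed

lemma Perm_ex1:
  assumes "generic S"
  shows "\<exists>!\<tau>. \<tau> permutes {1..card S} \<and> (\<forall>p\<in>S. \<tau> (left_rank S p) = bottom_rank S p)"
proof -
  have L: "bij_betw (left_rank S) S {1..card S}" and B: "bij_betw (bottom_rank S) S {1..card S}"
    using assms bij_betw_rank[of S fst] bij_betw_rank[of S snd]
    by (auto simp: generic_def left_rank_def[abs_def] bottom_rank_def[abs_def])
  define \<sigma> where "\<sigma> = bottom_rank S \<circ> inv_into S (left_rank S)"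
  define \<tau> where "\<tau> i = (if i \<in> {1..card S} then \<sigma> i else i)" for i
  have "bij_betw \<sigma> {1..card S} {1..card S}"
    unfolding \<sigma>_def by (rule bij_betw_trans[OF bij_betw_inv_into[OF L] B])
  then have "bij_betw \<tau> {1..card S} {1..card S}"
    by (rule bij_betw_cong[THEN iffD1, rotated]) (simp add: \<tau>_def)
  then have perm: "\<tau> permutes {1..card S}"
    by (rule bij_imp_permutes) (auto simp: \<tau>_def)
  have rank: "\<tau> (left_rank S p) = bottom_rank S p" if "p \<in> S" for p
    using that L by (auto simp: \<tau>_def \<sigma>_def bij_betw_def inv_into_f_f)
  show ?thesis
  proof (rule ex1I[of _ \<tau>])
    fix \<rho> assume \<rho>: "\<rho> permutes {1..card S} \<and> (\<forall>p\<in>S. \<rho> (left_rank S p) = bottom_rank S p)"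
    show "\<rho> = \<tau>"
    proof
      fix i show "\<rho> i = \<tau> i"
      proof (cases "i \<in> {1..card S}")
        case True
        then obtain p where "p \<in> S" "i = left_rank S p"
          using L by (auto simp: bij_betw_def image_iff dest!: equalityD2)
        then show ?thesis using \<rho> rank by simp
      next
        case False
        then show ?thesis
          using permutes_not_in[of \<rho> "{1..card S}" i] permutes_not_in[OF perm, of i] \<rho> by metis
      qed
    qed
  qed (use perm rank in auto)
qed

definition unif :: "real measure" where
  "unif = uniform_measure lborel {0..1}"

definition Leb_diag :: "(real \<times> real) measure" where
  "Leb_diag = distr unif borel (\<lambda>u. (u, u))"

definition Leb_square :: "(real \<times> real) measure" where
  "Leb_square = uniform_measure lborel ({0..1} \<times> {0..1})"

definition mixture :: "real \<Rightarrow> (real \<times> real) measure" where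
  "mixture p = measure_of UNIV (sets borel)
     (\<lambda>A. ennreal p * emeasure Leb_diag A + ennreal (1 - p) * emeasure Leb_square A)"

text \<open>\<^const>\<open>measure_of\<close> is the zero measure when the given set function is not a measure;
  the following facts show that this case does not occur.\<close>

lemma space_mixture [simp]: "space (mixture p) = UNIV"
  by (simp add: mixture_def space_measure_of_conv)

lemma sets_mixture [simp, measurable_cong]: "sets (mixture p) = sets borel"
  unfolding mixture_def using sets.sigma_sets_eq[of "borel :: (real \<times> real) measure"]
  by (simp add: sets_measure_of_conv)

lemma emeasure_mixture:
  assumes "A \<in> sets borel"
  shows "emeasure (mixture p) A =
           ennreal p * emeasure Leb_diag A + ennreal (1 - p) * emeasure Leb_square A"
proof (rule emeasure_measure_of[OF mixture_def])
  have sD: "sets Leb_diag = sets borel" and sS: "sets Leb_square = sets borel"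
    by (simp_all add: Leb_diag_def Leb_square_def)
  show "countably_additive (sets (mixture p))
     (\<lambda>A. ennreal p * emeasure Leb_diag A + ennreal (1 - p) * emeasure Leb_square A)"
    unfolding countably_additive_def
  proof (intro allI impI)
    fix F :: "nat \<Rightarrow> (real \<times> real) set"
    assume F: "range F \<subseteq> sets (mixture p)" "disjoint_family F"
    have "(\<Sum>i. emeasure Leb_diag (F i)) = emeasure Leb_diag (\<Union>i. F i)"
         "(\<Sum>i. emeasure Leb_square (F i)) = emeasure Leb_square (\<Union>i. F i)"
      using F by (auto intro!: suminf_emeasure simp: sD sS)
    then show "(\<Sum>i. ennreal p * emeasure Leb_diag (F i) +
                     ennreal (1 - p) * emeasure Leb_square (F i)) =
        ennreal p * emeasure Leb_diag (\<Union>i. F i) + ennreal (1 - p) * emeasure Leb_square (\<Union>i. F i)"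
      by (simp add: suminf_add[symmetric] ennreal_suminf_cmult)
  qed
qed (use assms in \<open>auto simp: positive_def\<close>)

lemma prob_space_mixture:
  assumes "0 \<le> p" "p \<le> 1"
  shows "prob_space (mixture p)"
proof
  have u: "prob_space unif"
    unfolding unif_def by (rule prob_space_uniform_measure) auto
  have "prob_space Leb_diag"
    unfolding Leb_diag_def by (rule prob_space.prob_space_distr[OF u]) (simp add: unif_def)
  then have D: "emeasure Leb_diag UNIV = 1"
    using prob_space.emeasure_space_1[of Leb_diag] by (simp add: Leb_diag_def)
  have "prob_space Leb_square"
    unfolding Leb_square_def
    by (rule prob_space_uniform_measure)
       (simp_all add: lborel_prod[symmetric] lborel.emeasure_pair_measure_Times)
  then have S: "emeasure Leb_square UNIV = 1"
    using prob_space.emeasure_space_1[of Leb_square] by (simp add: Leb_square_def)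
  show "emeasure (mixture p) (space (mixture p)) = 1"
    using assms by (simp add: emeasure_mixture D S ennreal_plus[symmetric] del: ennreal_plus)
qed

text \<open>The family \<open>Z\<close> is the canonical i.i.d. family, that is, the coordinates of the product
  space. Configurations with coinciding coordinates, for which \<^const>\<open>Perm\<close> is not defined,
  are excluded from the event. The condition on the cardinality excludes those
  in which some of the \<open>r\<close> points coincide.\<close>

definition \<psi> :: "nat \<Rightarrow> real \<Rightarrow> (nat \<Rightarrow> nat) \<Rightarrow> real \<times> real \<Rightarrow> real" where
  "\<psi> r p \<pi> z =
     (let P = (\<Pi>\<^sub>M i\<in>{1..r-1}. mixture p) in
      measure P {Z \<in> space P. let S = insert z (Z ` {1..r-1})
                              in card S = r \<and> generic S \<and> Perm S = \<pi>})"

definition covariance :: "'a measure \<Rightarrow> ('a \<Rightarrow> real) \<Rightarrow> ('a \<Rightarrow> real) \<Rightarrow> real" where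
  "covariance M X Y =
     prob_space.expectation M (\<lambda>\<omega>. (X \<omega> - prob_space.expectation M X) *
                                     (Y \<omega> - prob_space.expectation M Y))"

definition iid_uniform3 ::
  "'a measure \<Rightarrow> ('a \<Rightarrow> real) \<Rightarrow> ('a \<Rightarrow> real) \<Rightarrow> ('a \<Rightarrow> real) \<Rightarrow> bool" where
  "iid_uniform3 M U V W \<longleftrightarrow>
     prob_space.indep_vars M (\<lambda>_. borel) (\<lambda>i. [U, V, W] ! i) {..<3} \<and>
     distr M borel U = unif \<and> distr M borel V = unif \<and> distr M borel W = unif"

definition \<Sigma>\<^sub>d ::
  "'a measure \<Rightarrow> ('a \<Rightarrow> real) \<Rightarrow> ('a \<Rightarrow> real) \<Rightarrow> ('a \<Rightarrow> real) \<Rightarrow>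
   nat \<Rightarrow> real \<Rightarrow> real \<Rightarrow> (nat \<Rightarrow> nat) \<Rightarrow> real" where
  "\<Sigma>\<^sub>d M U V W r p\<^sub>1 p\<^sub>2 \<pi> =
     (p\<^sub>1 * prob_space.variance M (\<lambda>\<omega>. \<psi> r p\<^sub>1 \<pi> (U \<omega>, U \<omega>))
      + (1 - p\<^sub>1) * prob_space.variance M (\<lambda>\<omega>. \<psi> r p\<^sub>1 \<pi> (U \<omega>, V \<omega>))
      + p\<^sub>2 * covariance M (\<lambda>\<omega>. \<psi> r p\<^sub>1 \<pi> (U \<omega>, V \<omega>)) (\<lambda>\<omega>. \<psi> r p\<^sub>1 \<pi> (V \<omega>, U \<omega>))
      + 2 * (1 - p\<^sub>1 - p\<^sub>2) *
          covariance M (\<lambda>\<omega>. \<psi> r p\<^sub>1 \<pi> (U \<omega>, V \<omega>)) (\<lambda>\<omega>. \<psi> r p\<^sub>1 \<pi> (V \<omega>, W \<omega>)))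
     / (fact (r - 1))\<^sup>2"

end

theory Submission
  imports Defs
begin

text \<open>
  The reason for the positivity is that all four summands are nonnegative and the second one is
  positive.

  Reflection in the diagonal preserves the law of the random points and inverts permutations, so
  \<open>\<pi> = inv \<pi>\<close> makes \<open>f = \<psi> r p\<^sub>1 \<pi>\<close> symmetric (lemma
  \<open>\<psi>_swap\<close>). Hence the covariance of \<open>f (U, V)\<close> and \<open>f (V, U)\<close> is
  the variance of \<open>f (U, V)\<close>. The covariance of \<open>f (U, V)\<close> and
  \<open>f (V, W)\<close> is the variance of the conditional expectation of \<open>f (U, V)\<close> given
  \<open>V\<close> (lemma \<open>integral_chain_symmetric_nonneg\<close>), so it is nonnegative as well.

  It remains to see that \<open>f (U, V)\<close> is not almost surely constant when
  \<open>p\<^sub>1 < 1\<close> (lemma \<open>\<psi>_not_AE_const\<close>). On one cell of the diagram of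
  \<open>\<pi>\<close>, \<open>f\<close> is bounded below by the positive probability that the other
  \<open>r - 1\<close> points fall into the other cells. On the other hand, a point close to the bottom
  left corner is most likely leftmost and lowest, and one close to the top left corner leftmost and
  highest. Since \<open>\<pi> 1\<close> cannot be both \<open>1\<close> and \<open>r\<close>,
  \<open>f\<close> tends to \<open>0\<close> at one of these two corners.
\<close>

section \<open>Patterns of indexed configurations\<close>

text \<open>Ranks are counted on the indices \<open>{1..r}\<close> instead of the points, so that they
  depend on the configuration through comparisons of coordinates alone. In this form the event is visibly measurable and can be
  checked by counting indices; sets of points and the definite description in \<^const>\<open>Perm\<close>
  are no longer involved.\<close>

definition has_pattern :: "nat \<Rightarrow> (nat \<Rightarrow> nat) \<Rightarrow> (nat \<Rightarrow> real \<times> real) \<Rightarrow> bool" where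
  "has_pattern r \<pi> w \<longleftrightarrow> inj_on (\<lambda>i. fst (w i)) {1..r} \<and> inj_on (\<lambda>i. snd (w i)) {1..r} \<and>
     (\<forall>i\<in>{1..r}. \<pi> (card {j\<in>{1..r}. fst (w j) \<le> fst (w i)}) =
                  card {j\<in>{1..r}. snd (w j) \<le> snd (w i)})"

text \<open>If the coordinates are pairwise distinct, the indexing is injective, so ranks
  count indices, and \<^const>\<open>Perm\<close> is the only permutation that sends left ranks to
  bottom ranks. If a coordinate is repeated, then two of the points coincide or the set is not
  generic, and both sides are false.\<close>

lemma has_pattern_iff_Perm:
  assumes "\<pi> permutes {1..r}"
  shows "has_pattern r \<pi> w \<longleftrightarrow>
           card (w ` {1..r}) = r \<and> generic (w ` {1..r}) \<and> Perm (w ` {1..r}) = \<pi>"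
proof (cases "inj_on (\<lambda>i. fst (w i)) {1..r} \<and> inj_on (\<lambda>i. snd (w i)) {1..r}")
  case True
  let ?S = "w ` {1..r}"
  have inj: "inj_on w {1..r}"
    by (rule inj_on_imageI2[of fst]) (use True in \<open>simp add: comp_def\<close>)
  have card: "card ?S = r"
    using card_image[OF inj] by simp
  have gen: "generic ?S"
    unfolding generic_def using True
    by (intro conjI inj_on_imageI) (simp_all add: comp_def)
  have count: "card {q \<in> ?S. Q q} = card {j\<in>{1..r}. Q (w j)}" for Q
  proof -
    have "{q \<in> ?S. Q q} = w ` {j\<in>{1..r}. Q (w j)}" by auto
    moreover have "inj_on w {j\<in>{1..r}. Q (w j)}"
      by (rule inj_on_subset[OF inj]) auto
    ultimately show ?thesis
      by (simp only: card_image)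
  qed
  let ?Q = "\<lambda>\<tau>. \<tau> permutes {1..card ?S} \<and> (\<forall>p\<in>?S. \<tau> (left_rank ?S p) = bottom_rank ?S p)"
  have "Perm ?S = \<pi> \<longleftrightarrow> ?Q \<pi>"
  proof
    assume "Perm ?S = \<pi>"
    then show "?Q \<pi>"
      using theI'[OF Perm_ex1[OF gen]] unfolding Perm_def by fast
  next
    assume "?Q \<pi>"
    then show "Perm ?S = \<pi>"
      unfolding Perm_def by (rule the1_equality[OF Perm_ex1[OF gen]])
  qed
  then have "Perm ?S = \<pi> \<longleftrightarrow> (\<forall>p\<in>?S. \<pi> (left_rank ?S p) = bottom_rank ?S p)"
    using assms by (simp only: card simp_thms)
  also have "\<dots> \<longleftrightarrow> (\<forall>i\<in>{1..r}. \<pi> (card {j\<in>{1..r}. fst (w j) \<le> fst (w i)}) =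
                  card {j\<in>{1..r}. snd (w j) \<le> snd (w i)})"
    unfolding left_rank_def bottom_rank_def count by blast
  finally show ?thesis
    using True card gen by (simp add: has_pattern_def)
next
  case False
  have "\<not> (card (w ` {1..r}) = r \<and> generic (w ` {1..r}))"
  proof
    assume *: "card (w ` {1..r}) = r \<and> generic (w ` {1..r})"
    then have "inj_on w {1..r}"
      by (intro eq_card_imp_inj_on) simp_all
    then have "inj_on (fst \<circ> w) {1..r}" "inj_on (snd \<circ> w) {1..r}"
      using * unfolding generic_def by (simp_all only: comp_inj_on)
    with False show False by (simp add: comp_def)
  qed
  with False show ?thesis by (auto simp: has_pattern_def)
qed

lemma has_pattern_cong:
  assumes "\<And>i. i \<in> {1..r} \<Longrightarrow> w i = w' i"
  shows "has_pattern r \<pi> w \<longleftrightarrow> has_pattern r \<pi> w'"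
proof -
  have "card {j\<in>{1..r}. f (w j) \<le> f (w i)} = card {j\<in>{1..r}. f (w' j) \<le> f (w' i)}"
    if "i \<in> {1..r}" for f :: "real \<times> real \<Rightarrow> real" and i
    using that assms by (intro arg_cong[where f=card]) auto
  then show ?thesis
    using assms by (auto simp: has_pattern_def inj_on_def simp del: atLeastAtMost_iff)
qed

text \<open>Reflection in the diagonal exchanges the two ranks of each point.\<close>

lemma has_pattern_swap:
  assumes "\<pi> permutes {1..r}"
  shows "has_pattern r (inv \<pi>) (\<lambda>i. prod.swap (w i)) \<longleftrightarrow> has_pattern r \<pi> w"
  by (auto simp: has_pattern_def permutes_inv_eq[OF assms])

text \<open>The \<open>i\<close>-th point of the permutation diagram of \<open>\<pi>\<close>, thickened to
  an open square of side \<open>1/r\<close>.\<close>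

definition pattern_cell :: "nat \<Rightarrow> (nat \<Rightarrow> nat) \<Rightarrow> nat \<Rightarrow> (real \<times> real) set" where
  "pattern_cell r \<pi> i = {(real i - 1) / r <..< real i / r} \<times> {(real (\<pi> i) - 1) / r <..< real (\<pi> i) / r}"

lemma cell_bounds:
  assumes "i \<in> {1..r::nat}"
  shows "0 \<le> (real i - 1) / r" "(real i - 1) / r < real i / r" "real i / r \<le> 1"
  using assms by (auto simp: divide_strict_right_mono)

text \<open>The intervals with different indices are disjoint and ordered like their indices. The
  order of two distinct points of the same interval is not determined by the index, hence the last
  assumption.\<close>

lemma cell_le_iff:
  fixes x y :: real and i j r :: nat
  assumes "r \<ge> 1" "x \<in> {(real i - 1) / r <..< real i / r}" "y \<in> {(real j - 1) / r <..< real j / r}"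
    and "i = j \<Longrightarrow> x = y"
  shows "x \<le> y \<longleftrightarrow> i \<le> j"
proof (cases i j rule: linorder_cases)
  case less
  then have "real i / r \<le> (real j - 1) / r"
    using assms(1) by (intro divide_right_mono) auto
  with assms less show ?thesis by auto
next
  case greater
  then have "real j / r \<le> (real i - 1) / r"
    using assms(1) by (intro divide_right_mono) auto
  with assms greater show ?thesis by auto
qed (use assms in auto)

text \<open>The coordinates of the points compare exactly as \<open>i\<close> and
  \<open>\<pi> i\<close> do, so that the point in cell \<open>i\<close> has ranks
  \<open>i\<close> and \<open>\<pi> i\<close>.\<close>

lemma has_pattern_cells:
  assumes r: "r \<ge> 1" and \<pi>: "\<pi> permutes {1..r}"
    and w: "\<And>i. i \<in> {1..r} \<Longrightarrow> w i \<in> pattern_cell r \<pi> i"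
  shows "has_pattern r \<pi> w"
proof -
  have fst: "fst (w i) \<le> fst (w j) \<longleftrightarrow> i \<le> j" if "i \<in> {1..r}" "j \<in> {1..r}" for i j
    using w[OF that(1)] w[OF that(2)] by (intro cell_le_iff[OF r]) (auto simp: pattern_cell_def)
  have snd: "snd (w i) \<le> snd (w j) \<longleftrightarrow> \<pi> i \<le> \<pi> j" if "i \<in> {1..r}" "j \<in> {1..r}" for i j
    using w[OF that(1)] w[OF that(2)]
    by (intro cell_le_iff[OF r]) (auto simp: pattern_cell_def inj_eq[OF permutes_inj[OF \<pi>]])
  have "inj_on (\<lambda>i. fst (w i)) {1..r}"
  proof (rule inj_onI)
    fix i j assume "i \<in> {1..r}" "j \<in> {1..r}" "fst (w i) = fst (w j)"
    then show "i = j" using fst[of i j] fst[of j i] by simp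
  qed
  moreover have "inj_on (\<lambda>i. snd (w i)) {1..r}"
  proof (rule inj_onI)
    fix i j assume "i \<in> {1..r}" "j \<in> {1..r}" "snd (w i) = snd (w j)"
    then have "\<pi> i = \<pi> j" using snd[of i j] snd[of j i] by simp
    then show "i = j" by (simp add: inj_eq[OF permutes_inj[OF \<pi>]])
  qed
  moreover have "\<pi> (card {j\<in>{1..r}. fst (w j) \<le> fst (w i)}) =
      card {j\<in>{1..r}. snd (w j) \<le> snd (w i)}" if i: "i \<in> {1..r}" for i
  proof -
    have "{j\<in>{1..r}. fst (w j) \<le> fst (w i)} = {1..i}"
      using fst i by auto
    moreover have "card {j\<in>{1..r}. snd (w j) \<le> snd (w i)} = \<pi> i"
    proof -
      have \<pi>i: "\<pi> i \<in> {1..r}" using permutes_in_image[OF \<pi>] i by blast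
      have "{j\<in>{1..r}. snd (w j) \<le> snd (w i)} = {j\<in>{1..r}. \<pi> j \<le> \<pi> i}"
        using snd i by auto
      moreover have "\<pi> ` {j\<in>{1..r}. \<pi> j \<le> \<pi> i} = {1..\<pi> i}"
      proof -
        have "\<pi> ` {j\<in>{1..r}. \<pi> j \<le> \<pi> i} = {k \<in> \<pi> ` {1..r}. k \<le> \<pi> i}" by auto
        then show ?thesis using \<pi>i unfolding permutes_image[OF \<pi>] by auto
      qed
      moreover have "inj_on \<pi> {j\<in>{1..r}. \<pi> j \<le> \<pi> i}"
        using permutes_inj[OF \<pi>] by (rule inj_on_subset) simp
      ultimately show ?thesis
        using card_image[of \<pi> "{j\<in>{1..r}. \<pi> j \<le> \<pi> i}"] by simp
    qed
    ultimately show ?thesis by simp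
  qed
  ultimately show ?thesis by (simp add: has_pattern_def)
qed

lemma borel_prod_fst_snd [measurable]:
  "fst \<in> borel_measurable (borel :: (real \<times> real) measure)"
  "snd \<in> borel_measurable (borel :: (real \<times> real) measure)"
  by (auto intro!: borel_measurable_continuous_onI continuous_intros)

lemma pred_eq_count_space:
  fixes L R :: "'a \<Rightarrow> nat"
  assumes L: "L \<in> N \<rightarrow>\<^sub>M count_space UNIV" and R: "R \<in> N \<rightarrow>\<^sub>M count_space UNIV"
  shows "Measurable.pred N (\<lambda>x. g (L x) = R x)"
proof -
  have eq: "Measurable.pred N (\<lambda>x. f x = n)" if "f \<in> N \<rightarrow>\<^sub>M count_space UNIV" for f :: "'a \<Rightarrow> nat" and n
    using measurable_compose[OF that, of "\<lambda>m. m = n" "count_space UNIV"] by simp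
  have "Measurable.pred N (\<lambda>x. \<exists>n. L x = n \<and> R x = g n)"
    by (intro pred_intros_countable pred_intros_logic eq L R)
  then show ?thesis by (simp add: eq_commute)
qed

text \<open>There are finitely many comparisons of coordinates, and each rank is a measurable
  function with values in a discrete space.\<close>

lemma pred_has_pattern:
  assumes [measurable]: "\<And>i. i \<in> {1..r} \<Longrightarrow> (\<lambda>x. w x i) \<in> borel_measurable N"
  shows "Measurable.pred N (\<lambda>x. has_pattern r \<pi> (w x))"
proof -
  have card: "(\<lambda>x. card {j\<in>{1..r}. f (w x j) \<le> f (w x i)}) \<in> N \<rightarrow>\<^sub>M count_space UNIV"
    if [measurable]: "f \<in> borel_measurable borel" and i: "i \<in> {1..r}"
    for f :: "real \<times> real \<Rightarrow> real" and i
  proof (rule measurable_card)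
    fix j
    have "{x \<in> space N. f (w x j) \<le> f (w x i)} \<in> sets N" if "j \<in> {1..r}"
      using that i assms by measurable
    then show "{x \<in> space N. j \<in> {j\<in>{1..r}. f (w x j) \<le> f (w x i)}} \<in> sets N"
      by (cases "j \<in> {1..r}") simp_all
  qed
  have inj: "Measurable.pred N (\<lambda>x. inj_on (\<lambda>i. f (w x i)) {1..r})"
    if [measurable]: "f \<in> borel_measurable borel" for f :: "real \<times> real \<Rightarrow> real"
    unfolding inj_on_def by measurable
  have rank: "Measurable.pred N (\<lambda>x. \<pi> (card {j\<in>{1..r}. fst (w x j) \<le> fst (w x i)}) =
                  card {j\<in>{1..r}. snd (w x j) \<le> snd (w x i)})" if "i \<in> {1..r}" for i
    by (rule pred_eq_count_space[OF card[OF borel_prod_fst_snd(1) that] card[OF borel_prod_fst_snd(2) that]])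
  have "Measurable.pred N (\<lambda>x. \<forall>i\<in>{1..r}. \<pi> (card {j\<in>{1..r}. fst (w x j) \<le> fst (w x i)}) =
                  card {j\<in>{1..r}. snd (w x j) \<le> snd (w x i)})"
    by (rule pred_intros_finite(3)[OF finite_atLeastAtMost rank])
  from pred_intros_logic(3)[OF inj[OF borel_prod_fst_snd(1)]
      pred_intros_logic(3)[OF inj[OF borel_prod_fst_snd(2)] this]]
  show ?thesis
    by (simp only: has_pattern_def)
qed

section \<open>The law of the random points\<close>

lemma prob_space_unif: "prob_space unif"
  unfolding unif_def by (rule prob_space_uniform_measure) auto

lemma sets_unif [simp, measurable_cong]: "sets unif = sets borel"
  and space_unif [simp]: "space unif = UNIV"
  by (simp_all add: unif_def)

lemma emeasure_unif: "A \<in> sets borel \<Longrightarrow> emeasure unif A = emeasure lborel ({0..1} \<inter> A)"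
  by (simp add: unif_def divide_ennreal_def)

lemma emeasure_unif_greaterThanLessThan:
  assumes "0 \<le> a" "a \<le> b" "b \<le> 1"
  shows "emeasure unif {a<..<b} = ennreal (b - a)"
proof -
  have "{0..1} \<inter> {a<..<b} = {a<..<b}" using assms by auto
  then show ?thesis using assms by (simp add: emeasure_unif)
qed

interpretation unif: prob_space unif by (rule prob_space_unif)

interpretation unif2: pair_prob_space unif unif ..

lemma sets_unif2 [simp, measurable_cong]: "sets (unif \<Otimes>\<^sub>M unif) = sets borel"
proof -
  have "sets (unif \<Otimes>\<^sub>M unif) = sets (borel \<Otimes>\<^sub>M borel)"
    by (rule sets_pair_measure_cong) simp_all
  then show ?thesis by (simp only: borel_prod)
qed

lemma space_unif2 [simp]: "space (unif \<Otimes>\<^sub>M unif) = UNIV"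
  by (simp add: space_pair_measure)

lemma Leb_square_eq: "Leb_square = unif \<Otimes>\<^sub>M unif"
proof (rule sym, rule pair_measure_eqI)
  show "sets (unif \<Otimes>\<^sub>M unif) = sets Leb_square"
    by (simp only: sets_unif2 Leb_square_def sets_uniform_measure sets_lborel)
  fix A B assume AB: "A \<in> sets unif" "B \<in> sets unif"
  then have [measurable]: "A \<in> sets borel" "B \<in> sets borel" by auto
  have "({0..1} \<times> {0..1}) \<inter> (A \<times> B) = ({0..1} \<inter> A) \<times> ({0..1} \<inter> B)" by auto
  moreover have "A \<times> B \<in> sets borel"
    unfolding borel_prod[symmetric] by measurable
  moreover have "({0..1::real} \<times> {0..1::real}) \<in> sets borel"
    unfolding borel_prod[symmetric] by measurable
  ultimately show "emeasure unif A * emeasure unif B = emeasure Leb_square (A \<times> B)"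
    by (simp add: Leb_square_def emeasure_unif lborel_prod[symmetric]
          lborel.emeasure_pair_measure_Times divide_ennreal_def del: Times_Int_Times)
qed unfold_locales

lemma emeasure_Leb_diag:
  "A \<in> sets borel \<Longrightarrow> emeasure Leb_diag A = emeasure unif {u. (u, u) \<in> A}"
  unfolding Leb_diag_def
  by (subst emeasure_distr) (auto simp: vimage_def borel_prod[symmetric])

lemma swap_borel [measurable]: "prod.swap \<in> borel \<rightarrow>\<^sub>M (borel :: (real \<times> real) measure)"
  unfolding borel_prod[symmetric] prod.swap_def by measurable

text \<open>Both the diagonal and the square are mapped to themselves by the reflection, and so are
  their uniform measures.\<close>

lemma mixture_swap: "distr (mixture p) (mixture p) prod.swap = mixture p"
proof (rule measure_eqI)
  fix A assume "A \<in> sets (distr (mixture p) (mixture p) prod.swap)"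
  then have [measurable]: "A \<in> sets borel" by simp
  let ?B = "prod.swap -` A"
  have B: "?B \<in> sets borel"
    using measurable_sets[OF swap_borel, of A] by simp
  have "(\<lambda>(x, y). (y, x)) = (prod.swap :: real \<times> real \<Rightarrow> _)" by auto
  then have "distr Leb_square Leb_square prod.swap = Leb_square"
    using unif2.distr_pair_swap by (simp add: Leb_square_eq)
  then have "emeasure Leb_square ?B = emeasure Leb_square A"
    using emeasure_distr[of prod.swap Leb_square Leb_square A] swap_borel
    by (simp add: Leb_square_eq cong: measurable_cong_sets)
  moreover have "emeasure Leb_diag ?B = emeasure Leb_diag A"
    using B by (simp add: emeasure_Leb_diag)
  ultimately show "emeasure (distr (mixture p) (mixture p) prod.swap) A = emeasure (mixture p) A"
    using B by (subst emeasure_distr) (simp_all add: emeasure_mixture)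
qed simp

text \<open>Both components of the mixture have uniform marginals, hence the bounds on strips do
  not depend on \<open>p\<close>.\<close>

lemma emeasure_mixture_fst:
  assumes [measurable]: "A \<in> sets borel" and "0 \<le> p" "p \<le> 1"
  shows "emeasure (mixture p) {z. fst z \<in> A} = emeasure unif A"
proof -
  have "{z. fst z \<in> A} = A \<times> (UNIV :: real set)" by auto
  then have "emeasure Leb_square {z. fst z \<in> A} = emeasure unif A"
    using unif.emeasure_space_1 by (simp add: Leb_square_eq unif.emeasure_pair_measure_Times)
  moreover have "{z::real \<times> real. fst z \<in> A} \<in> sets borel" by measurable
  ultimately show ?thesis
    using assms by (simp add: emeasure_mixture emeasure_Leb_diag distrib_right[symmetric]
                       ennreal_plus[symmetric] del: ennreal_plus)
qed

lemma emeasure_mixture_snd: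
  assumes [measurable]: "A \<in> sets borel" and "0 \<le> p" "p \<le> 1"
  shows "emeasure (mixture p) {z. snd z \<in> A} = emeasure unif A"
proof -
  have "{z::real \<times> real. snd z \<in> A} \<in> sets borel" by measurable
  then have "emeasure (distr (mixture p) (mixture p) prod.swap) {z. snd z \<in> A} =
        emeasure (mixture p) {z. fst z \<in> A}"
    by (subst emeasure_distr) (auto simp: vimage_def)
  then show ?thesis
    by (simp add: mixture_swap emeasure_mixture_fst[OF assms])
qed

text \<open>The frame is covered by two strips of width \<open>e\<close> for each coordinate.\<close>

lemma emeasure_mixture_frame_le:
  assumes p: "0 \<le> p" "p \<le> 1" and e: "0 < e" "e < 1/2"
  shows "emeasure (mixture p) (- ({e<..<1-e} \<times> {e<..<1-e})) \<le> ennreal (4 * e)"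
proof -
  let ?A = "- {e<..<1-e}"
  have "{0..1} \<inter> ?A = {0..e} \<union> {1-e..1}" using e by auto
  then have "emeasure unif ?A \<le> emeasure lborel {0..e} + emeasure lborel {1-e..1}"
    using emeasure_subadditive[of "{0..e}" lborel "{1-e..1}"] by (simp add: emeasure_unif)
  also have "\<dots> = ennreal (2 * e)"
    using e by (simp add: ennreal_plus[symmetric] del: ennreal_plus)
  finally have A: "emeasure unif ?A \<le> ennreal (2 * e)" .
  have "emeasure (mixture p) (- ({e<..<1-e} \<times> {e<..<1-e})) =
        emeasure (mixture p) ({z. fst z \<in> ?A} \<union> {z. snd z \<in> ?A})"
    by (rule arg_cong[where f="emeasure _"]) auto
  also have "\<dots> \<le> emeasure (mixture p) {z. fst z \<in> ?A} + emeasure (mixture p) {z. snd z \<in> ?A}"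
    by (rule emeasure_subadditive) measurable
  also have "\<dots> = emeasure unif ?A + emeasure unif ?A"
    using p by (simp only: emeasure_mixture_fst emeasure_mixture_snd borel_comp
        borel_open[OF open_greaterThanLessThan])
  also have "\<dots> \<le> ennreal (2 * e) + ennreal (2 * e)"
    by (intro add_mono A)
  also have "\<dots> = ennreal (4 * e)"
    using e by (simp add: ennreal_plus[symmetric] del: ennreal_plus)
  finally show ?thesis .
qed

text \<open>The diagonal may miss the box, but the square component has positive weight when
  \<open>p < 1\<close>.\<close>

lemma emeasure_mixture_box_pos:
  assumes "0 \<le> p" "p < 1" and "0 \<le> a" "a < b" "b \<le> 1" and "0 \<le> c" "c < d" "d \<le> 1"
  shows "emeasure (mixture p) ({a<..<b} \<times> {c<..<d}) > 0"
proof -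
  have "{a<..<b} \<times> {c<..<d} \<in> sets (borel \<Otimes>\<^sub>M borel)" by measurable
  then have "{a<..<b} \<times> {c<..<d} \<in> sets borel" by (simp only: borel_prod)
  moreover have "emeasure Leb_square ({a<..<b} \<times> {c<..<d}) = ennreal ((b - a) * (d - c))"
    using assms by (simp add: Leb_square_eq unif.emeasure_pair_measure_Times
        emeasure_unif_greaterThanLessThan ennreal_mult)
  ultimately show ?thesis
    using assms by (simp add: emeasure_mixture ennreal_mult[symmetric] add_nonneg_pos)
qed

lemma prob_space_PiM_mixture:
  assumes "0 \<le> p" "p \<le> 1"
  shows "prob_space (\<Pi>\<^sub>M i\<in>I. mixture p)"
  using assms by (intro prob_space_PiM prob_space_mixture)

section \<open>The pattern probability as a function of the free point\<close>

lemma \<psi>_eq_prob_has_pattern: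
  assumes "r \<ge> 1" "\<pi> permutes {1..r}"
  shows "\<psi> r p \<pi> z = measure (\<Pi>\<^sub>M i\<in>{1..r-1}. mixture p)
           {Z \<in> space (\<Pi>\<^sub>M i\<in>{1..r-1}. mixture p). has_pattern r \<pi> (Z(r := z))}"
proof -
  have image: "(Z(r := z)) ` {1..r} = insert z (Z ` {1..r-1})" for Z :: "nat \<Rightarrow> real \<times> real"
  proof -
    have split: "{1..r} = insert r {1..r-1}" using assms(1) by auto
    have "(Z(r := z)) ` {1..r-1} = Z ` {1..r-1}"
      using assms(1) by (intro image_cong) auto
    then show ?thesis
      unfolding split image_insert by (metis fun_upd_same)
  qed
  show ?thesis
    unfolding \<psi>_def Let_def has_pattern_iff_Perm[OF assms(2)] image ..
qed

text \<open>The free point gets the last index \<open>r\<close>. Joint measurability in the point and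
  the random configuration is what makes the section probability \<open>\<psi>\<close> measurable.\<close>

lemma pred_has_pattern_insert:
  "Measurable.pred (borel \<Otimes>\<^sub>M (\<Pi>\<^sub>M i\<in>{1..r-1}. mixture p)) (\<lambda>x. has_pattern r \<pi> ((snd x)(r := fst x)))"
proof (rule pred_has_pattern)
  fix i assume i: "i \<in> {1..r}"
  show "(\<lambda>x. ((snd x)(r := fst x)) i) \<in>
          borel_measurable ((borel :: (real \<times> real) measure) \<Otimes>\<^sub>M (\<Pi>\<^sub>M i\<in>{1..r-1}. mixture p))"
  proof (cases "i = r")
    case False
    then have "i \<in> {1..r-1}" using i by auto
    then have "(\<lambda>Z. Z i) \<in> (\<Pi>\<^sub>M i\<in>{1..r-1}. mixture p) \<rightarrow>\<^sub>M mixture p"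
      by (rule measurable_component_singleton)
    then have "(\<lambda>Z. Z i) \<in> (\<Pi>\<^sub>M i\<in>{1..r-1}. mixture p) \<rightarrow>\<^sub>M borel"
      by (simp cong: measurable_cong_sets)
    from measurable_compose[OF measurable_snd this] False show ?thesis by simp
  qed simp
qed

lemma sets_has_pattern:
  "{Z \<in> space (\<Pi>\<^sub>M i\<in>{1..r-1}. mixture p). has_pattern r \<pi> (Z(r := z))}
     \<in> sets (\<Pi>\<^sub>M i\<in>{1..r-1}. mixture p)"
proof -
  have "(\<lambda>Z. (z, Z)) \<in> (\<Pi>\<^sub>M i\<in>{1..r-1}. mixture p) \<rightarrow>\<^sub>M borel \<Otimes>\<^sub>M (\<Pi>\<^sub>M i\<in>{1..r-1}. mixture p)"
    by simp
  from measurable_compose[OF this pred_has_pattern_insert] show ?thesis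
    by (simp add: pred_def)
qed

lemma measurable_\<psi>:
  assumes "0 \<le> p" "p \<le> 1" "r \<ge> 1" "\<pi> permutes {1..r}"
  shows "\<psi> r p \<pi> \<in> borel_measurable borel"
proof -
  let ?P = "\<Pi>\<^sub>M i\<in>{1..r-1}. mixture p"
  interpret P: prob_space ?P by (rule prob_space_PiM_mixture) fact+
  have "{x \<in> space (borel \<Otimes>\<^sub>M ?P). has_pattern r \<pi> ((snd x)(r := fst x))} \<in> sets (borel \<Otimes>\<^sub>M ?P)"
    using pred_has_pattern_insert by (simp only: pred_def)
  from P.measurable_emeasure_Pair[OF this]
  have "(\<lambda>z. measure ?P (Pair z -` {x \<in> space (borel \<Otimes>\<^sub>M ?P). has_pattern r \<pi> ((snd x)(r := fst x))}))
          \<in> borel_measurable borel"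
    unfolding measure_def by measurable
  moreover have "Pair z -` {x \<in> space (borel \<Otimes>\<^sub>M ?P). has_pattern r \<pi> ((snd x)(r := fst x))} =
      {Z \<in> space ?P. has_pattern r \<pi> (Z(r := z))}" for z
    by (auto simp: space_pair_measure)
  ultimately show ?thesis
    unfolding \<psi>_eq_prob_has_pattern[OF assms(3,4), abs_def] by simp
qed

lemma \<psi>_nonneg: "0 \<le> \<psi> r p \<pi> z"
  by (simp add: \<psi>_def Let_def)

lemma \<psi>_le_1:
  assumes "0 \<le> p" "p \<le> 1"
  shows "\<psi> r p \<pi> z \<le> 1"
  using prob_space.prob_le_1[OF prob_space_PiM_mixture[OF assms]] by (simp add: \<psi>_def Let_def)

text \<open>Reflecting the free point together with all random points replaces the pattern by its
  inverse, and the law of the random points does not change. For an involution \<open>\<pi>\<close> this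
  makes \<open>\<psi>\<close> a symmetric function.\<close>

lemma \<psi>_swap:
  assumes p: "0 \<le> p" "p \<le> 1" and r: "r \<ge> 1" and \<pi>: "\<pi> permutes {1..r}"
  shows "\<psi> r p (inv \<pi>) (prod.swap z) = \<psi> r p \<pi> z"
proof -
  let ?I = "{1..r-1}"
  let ?P = "\<Pi>\<^sub>M i\<in>?I. mixture p"
  have sw: "prod.swap \<in> mixture p \<rightarrow>\<^sub>M mixture p"
    using swap_borel by (simp cong: measurable_cong_sets)
  then have comp: "compose ?I prod.swap \<in> ?P \<rightarrow>\<^sub>M ?P"
    unfolding compose_def
    by (intro measurable_restrict measurable_compose[OF measurable_component_singleton])
  have "distr ?P ?P (compose ?I prod.swap) = (\<Pi>\<^sub>M i\<in>?I. distr (mixture p) (mixture p) prod.swap)"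
    by (rule distr_PiM_finite_prob_space') (auto intro: prob_space_mixture p sw)
  then have "\<psi> r p (inv \<pi>) (prod.swap z) = measure (distr ?P ?P (compose ?I prod.swap))
      {Z \<in> space ?P. has_pattern r (inv \<pi>) (Z(r := prod.swap z))}"
    using \<psi>_eq_prob_has_pattern[OF r permutes_inv[OF \<pi>]] by (simp add: mixture_swap)
  also have "\<dots> = measure ?P (compose ?I prod.swap -`
      {Z \<in> space ?P. has_pattern r (inv \<pi>) (Z(r := prod.swap z))} \<inter> space ?P)"
    by (rule measure_distr[OF comp sets_has_pattern])
  also have "compose ?I prod.swap -`
      {Z \<in> space ?P. has_pattern r (inv \<pi>) (Z(r := prod.swap z))} \<inter> space ?P =
      {Z \<in> space ?P. has_pattern r \<pi> (Z(r := z))}"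
  proof -
    have "has_pattern r (inv \<pi>) ((compose ?I prod.swap Z)(r := prod.swap z)) \<longleftrightarrow>
            has_pattern r (inv \<pi>) (\<lambda>i. prod.swap ((Z(r := z)) i))" for Z
      by (rule has_pattern_cong) (auto simp: compose_def)
    then have iff: "has_pattern r (inv \<pi>) ((compose ?I prod.swap Z)(r := prod.swap z)) \<longleftrightarrow>
            has_pattern r \<pi> (Z(r := z))" for Z
      unfolding has_pattern_swap[OF \<pi>] .
    show ?thesis
      unfolding vimage_def Int_def mem_Collect_eq iff using measurable_space[OF comp] by blast
  qed
  also have "measure ?P \<dots> = \<psi> r p \<pi> z"
    by (rule \<psi>_eq_prob_has_pattern[OF r \<pi>, symmetric])
  finally show ?thesis .
qed

text \<open>With the free point in the cell of index \<open>r\<close>, the pattern occurs as soon as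
  each \<open>Z i\<close> falls into its own cell. The probability of this is a positive constant
  that does not depend on where in its cell the free point lies.\<close>

lemma \<psi>_lower_bound_on_cell:
  assumes p: "0 \<le> p" "p < 1" and r: "r \<ge> 1" and \<pi>: "\<pi> permutes {1..r}"
  obtains \<delta> where "\<delta> > 0" "\<And>z. z \<in> pattern_cell r \<pi> r \<Longrightarrow> \<psi> r p \<pi> z \<ge> \<delta>"
proof
  let ?I = "{1..r-1}"
  let ?P = "\<Pi>\<^sub>M i\<in>?I. mixture p"
  let ?\<delta> = "\<Prod>i\<in>?I. measure (mixture p) (pattern_cell r \<pi> i)"
  have p': "0 \<le> p" "p \<le> 1" using p by auto
  interpret mix: prob_space "mixture p" by (rule prob_space_mixture) fact+
  interpret P: finite_product_prob_space "\<lambda>_. mixture p" ?I by standard simp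
  have cell: "pattern_cell r \<pi> i \<in> sets (mixture p)" for i
  proof -
    have "pattern_cell r \<pi> i \<in> sets (borel \<Otimes>\<^sub>M borel)"
      unfolding pattern_cell_def by measurable
    then show ?thesis by (simp only: borel_prod sets_mixture)
  qed
  have "measure (mixture p) (pattern_cell r \<pi> i) > 0" if "i \<in> ?I" for i
  proof -
    have "\<pi> i \<in> {1..r}" using permutes_in_image[OF \<pi>, of i] that by auto
    then have "emeasure (mixture p) (pattern_cell r \<pi> i) > 0"
      unfolding pattern_cell_def using that cell_bounds[of i r] cell_bounds[of "\<pi> i" r]
      by (intro emeasure_mixture_box_pos p) auto
    then show ?thesis by (simp add: mix.emeasure_eq_measure)
  qed
  then show "?\<delta> > 0" by (intro prod_pos) auto
  fix z assume z: "z \<in> pattern_cell r \<pi> r"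
  have "?\<delta> = measure ?P (Pi\<^sub>E ?I (pattern_cell r \<pi>))"
    using cell by (intro P.prob_times[symmetric])
  also have "\<dots> \<le> measure ?P {Z \<in> space ?P. has_pattern r \<pi> (Z(r := z))}"
  proof (rule P.finite_measure_mono[OF subsetI sets_has_pattern])
    fix Z assume Z: "Z \<in> Pi\<^sub>E ?I (pattern_cell r \<pi>)"
    have "has_pattern r \<pi> (Z(r := z))"
    proof (rule has_pattern_cells[OF r \<pi>])
      fix i assume "i \<in> {1..r}"
      then show "(Z(r := z)) i \<in> pattern_cell r \<pi> i"
        using z PiE_mem[OF Z, of i] by auto
    qed
    moreover have "Z \<in> space ?P" using Z by (auto simp: space_PiM PiE_def)
    ultimately show "Z \<in> {Z \<in> space ?P. has_pattern r \<pi> (Z(r := z))}" by simp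
  qed
  also have "\<dots> = \<psi> r p \<pi> z"
    by (rule \<psi>_eq_prob_has_pattern[OF r \<pi>, symmetric])
  finally show "\<psi> r p \<pi> z \<ge> ?\<delta>" .
qed

text \<open>If no random point falls into the frame of width \<open>e\<close>, then a free point in the
  bottom left corner is both leftmost and lowest, which forces \<open>\<pi> 1 = 1\<close>; in the top left
  corner it is leftmost and highest, which forces \<open>\<pi> 1 = r\<close>. When the relevant equation
  fails, the pattern therefore requires one of the \<open>r - 1\<close> random points in the frame.\<close>

lemma \<psi>_le_in_corner:
  assumes p: "0 \<le> p" "p \<le> 1" and r: "r \<ge> 1" and \<pi>: "\<pi> permutes {1..r}"
    and e: "0 < e" "e < 1/2" and x: "x < e"
    and y: "y < e \<and> \<pi> 1 \<noteq> 1 \<or> y > 1 - e \<and> \<pi> 1 \<noteq> r"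
  shows "\<psi> r p \<pi> (x, y) \<le> real (r - 1) * (4 * e)"
proof -
  let ?I = "{1..r-1}"
  let ?P = "\<Pi>\<^sub>M i\<in>?I. mixture p"
  let ?F = "- ({e<..<1-e} \<times> {e<..<1-e})"
  interpret mix: prob_space "mixture p" by (rule prob_space_mixture) fact+
  interpret P: finite_product_prob_space "\<lambda>_. mixture p" ?I by standard simp
  have "{e<..<1-e} \<times> {e<..<1-e} \<in> sets (borel \<Otimes>\<^sub>M borel)" by measurable
  then have F: "?F \<in> sets (mixture p)"
    unfolding borel_prod sets_mixture by (rule borel_comp)
  have F_le: "measure (mixture p) ?F \<le> 4 * e"
    using emeasure_mixture_frame_le[OF p e] e by (simp add: mix.emeasure_eq_measure)
  define B where "B i = {Z \<in> space ?P. Z i \<in> ?F}" for i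
  have B: "B i \<in> sets ?P" if "i \<in> ?I" for i
    unfolding B_def by (rule sets_Collect_single[OF that F])
  have B_le: "measure ?P (B i) \<le> 4 * e" if "i \<in> ?I" for i
  proof -
    have "measure ?P (B i) = measure (distr ?P (mixture p) (\<lambda>Z. Z i)) ?F"
      by (subst measure_distr[OF measurable_component_singleton[OF that] F])
         (simp only: B_def vimage_def Int_def mem_Collect_eq conj_commute)
    also have "\<dots> = measure (mixture p) ?F"
      using P.PiM_component[OF that] by simp
    finally show ?thesis using F_le by simp
  qed
  have "{Z \<in> space ?P. has_pattern r \<pi> (Z(r := (x, y)))} \<subseteq> (\<Union>i\<in>?I. B i)"
  proof
    fix Z assume "Z \<in> {Z \<in> space ?P. has_pattern r \<pi> (Z(r := (x, y)))}"
    then have Z: "Z \<in> space ?P" and pat: "has_pattern r \<pi> (Z(r := (x, y)))" by auto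
    show "Z \<in> (\<Union>i\<in>?I. B i)"
    proof (rule ccontr)
      assume "Z \<notin> (\<Union>i\<in>?I. B i)"
      then have in_mid: "fst (Z i) \<in> {e<..<1-e} \<and> snd (Z i) \<in> {e<..<1-e}" if "i \<in> ?I" for i
        using Z that by (auto simp: B_def mem_Times_iff)
      define w where "w = Z(r := (x, y))"
      have w_r: "w r = (x, y)" by (simp add: w_def)
      have mid: "e < fst (w j)" "e < snd (w j)" "snd (w j) < 1 - e" if "j \<in> {1..r}" "j \<noteq> r" for j
        using in_mid[of j] that by (auto simp: w_def)
      have r_in: "r \<in> {1..r}" using r by simp
      have "fst (w j) \<le> x \<longleftrightarrow> j = r" if "j \<in> {1..r}" for j
        using mid(1)[OF that] x w_r by (cases "j = r") auto
      then have "{j\<in>{1..r}. fst (w j) \<le> fst (w r)} = {r}"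
        using r_in w_r by auto
      moreover have "\<pi> (card {j\<in>{1..r}. fst (w j) \<le> fst (w r)}) = card {j\<in>{1..r}. snd (w j) \<le> snd (w r)}"
        using pat r_in unfolding has_pattern_def w_def[symmetric] by blast
      ultimately have \<pi>1: "\<pi> 1 = card {j\<in>{1..r}. snd (w j) \<le> y}"
        by (simp add: w_r)
      from y show False
      proof
        assume *: "y < e \<and> \<pi> 1 \<noteq> 1"
        have "snd (w j) \<le> y \<longleftrightarrow> j = r" if "j \<in> {1..r}" for j
          using mid(2)[OF that] * w_r by (cases "j = r") auto
        then have "{j\<in>{1..r}. snd (w j) \<le> y} = {r}"
          using r_in by auto
        with * \<pi>1 show False by simp
      next
        assume *: "y > 1 - e \<and> \<pi> 1 \<noteq> r"
        have "snd (w j) \<le> y" if "j \<in> {1..r}" for j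
          using mid(3)[OF that] * w_r by (cases "j = r") auto
        then have "{j\<in>{1..r}. snd (w j) \<le> y} = {1..r}"
          by auto
        with * \<pi>1 show False by simp
      qed
    qed
  qed
  then have "\<psi> r p \<pi> (x, y) \<le> measure ?P (\<Union>i\<in>?I. B i)"
    unfolding \<psi>_eq_prob_has_pattern[OF r \<pi>] using B by (intro P.finite_measure_mono) auto
  also have "\<dots> \<le> (\<Sum>i\<in>?I. measure ?P (B i))"
    using B by (intro P.finite_measure_subadditive_finite) auto
  also have "\<dots> \<le> (\<Sum>i\<in>?I. 4 * e)"
    using B_le by (intro sum_mono) auto
  finally show ?thesis by simp
qed

text \<open>A constant value would have to be attained in every open box. The cell of index
  \<open>r\<close> shows that it is at least some \<open>\<delta> > 0\<close>. As \<open>r \<ge> 2\<close>,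
  at least one of \<open>\<pi> 1 \<noteq> 1\<close> and \<open>\<pi> 1 \<noteq> r\<close> holds, and a small
  enough box in the corresponding left corner shows that it is less than \<open>\<delta>\<close>.\<close>

lemma \<psi>_not_AE_const:
  assumes p: "0 \<le> p" "p < 1" and r: "r \<ge> 2" and \<pi>: "\<pi> permutes {1..r}"
  shows "\<not> (AE z in unif \<Otimes>\<^sub>M unif. \<psi> r p \<pi> z = c)"
proof
  assume AE: "AE z in unif \<Otimes>\<^sub>M unif. \<psi> r p \<pi> z = c"
  have attained: "\<exists>z \<in> {a<..<b} \<times> {a'<..<b'}. \<psi> r p \<pi> z = c"
    if "0 \<le> a" "a < b" "b \<le> 1" "0 \<le> a'" "a' < b'" "b' \<le> 1" for a b a' b' :: real
  proof (rule ccontr)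
    assume "\<not> ?thesis"
    with AE have "AE z in unif \<Otimes>\<^sub>M unif. z \<notin> {a<..<b} \<times> {a'<..<b'}"
      by (auto elim: eventually_mono)
    moreover have "{a<..<b} \<times> {a'<..<b'} \<in> sets (unif \<Otimes>\<^sub>M unif)" by (rule pair_measureI) auto
    ultimately have "emeasure (unif \<Otimes>\<^sub>M unif) ({a<..<b} \<times> {a'<..<b'}) = 0"
      using AE_iff_null_sets null_setsD1 by blast
    moreover have "emeasure (unif \<Otimes>\<^sub>M unif) ({a<..<b} \<times> {a'<..<b'}) = ennreal ((b - a) * (b' - a'))"
      using that by (simp add: unif.emeasure_pair_measure_Times emeasure_unif_greaterThanLessThan
          ennreal_mult)
    ultimately show False using that by (simp add: ennreal_eq_0_iff mult_le_0_iff)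
  qed
  have r1: "r \<ge> 1" using r by simp
  obtain \<delta> where \<delta>: "\<delta> > 0" "\<And>z. z \<in> pattern_cell r \<pi> r \<Longrightarrow> \<psi> r p \<pi> z \<ge> \<delta>"
    using \<psi>_lower_bound_on_cell[OF p r1 \<pi>] by blast
  have \<pi>r: "\<pi> r \<in> {1..r}" using permutes_in_image[OF \<pi>, of r] r by auto
  have "\<exists>z \<in> pattern_cell r \<pi> r. \<psi> r p \<pi> z = c"
    using attained[of "(real r - 1) / r" "real r / r" "(real (\<pi> r) - 1) / r" "real (\<pi> r) / r"]
      cell_bounds[OF \<pi>r] cell_bounds[of r r] r1
    unfolding pattern_cell_def by simp
  then have c: "c \<ge> \<delta>" using \<delta>(2) by blast
  \<comment> \<open>The frame estimate costs \<open>4 * e\<close> for each random point; the factor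
    \<open>8 * r\<close> leaves room for a strict inequality.\<close>
  define e where "e = min (1/4) (\<delta> / (8 * r))"
  have e: "0 < e" "e < 1/2" using \<delta>(1) r by (auto simp: e_def)
  have "real (r - 1) * (4 * e) \<le> real r * (4 * (\<delta> / (8 * r)))"
    using e by (intro mult_mono) (auto simp: e_def)
  also have "\<dots> < \<delta>" using \<delta>(1) r by simp
  finally have small: "real (r - 1) * (4 * e) < \<delta>" .
  have corner: "\<exists>x y. x < e \<and> (y < e \<and> \<pi> 1 \<noteq> 1 \<or> y > 1 - e \<and> \<pi> 1 \<noteq> r) \<and> \<psi> r p \<pi> (x, y) = c"
  proof (cases "\<pi> 1 = 1")
    case True
    then have "\<pi> 1 \<noteq> r" using r by simp
    then show ?thesis using attained[of 0 e "1 - e" 1] e by fastforce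
  next
    case False
    then show ?thesis using attained[of 0 e 0 e] e by fastforce
  qed
  then obtain x y where "x < e" "y < e \<and> \<pi> 1 \<noteq> 1 \<or> y > 1 - e \<and> \<pi> 1 \<noteq> r" "\<psi> r p \<pi> (x, y) = c"
    by blast
  then have "c \<le> real (r - 1) * (4 * e)"
    using \<psi>_le_in_corner[OF _ _ r1 \<pi> e, of p x y] p by auto
  with c small show False by simp
qed

section \<open>Variances and covariances\<close>

text \<open>The middle variable comes first in the triple because the covariance of the chain is
  computed by integrating over \<open>U\<close> and \<open>W\<close> with \<open>V\<close> held fixed.\<close>

lemma iid_uniform3_distr:
  assumes "prob_space M" and "iid_uniform3 M U V W"
  shows "distr M (borel \<Otimes>\<^sub>M borel) (\<lambda>\<omega>. (U \<omega>, V \<omega>)) = unif \<Otimes>\<^sub>M unif"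
    and "distr M (borel \<Otimes>\<^sub>M borel) (\<lambda>\<omega>. (V \<omega>, W \<omega>)) = unif \<Otimes>\<^sub>M unif"
    and "distr M (borel \<Otimes>\<^sub>M (borel \<Otimes>\<^sub>M borel)) (\<lambda>\<omega>. (V \<omega>, (U \<omega>, W \<omega>))) = unif \<Otimes>\<^sub>M (unif \<Otimes>\<^sub>M unif)"
proof -
  interpret prob_space M by fact
  let ?X = "\<lambda>i. [U, V, W] ! i"
  have ind: "indep_vars (\<lambda>_. borel) ?X {..<3::nat}"
    and dU: "distr M borel U = unif" and dV: "distr M borel V = unif" and dW: "distr M borel W = unif"
    using assms by (auto simp: iid_uniform3_def)
  have pair: "indep_var borel (?X i) borel (?X j)" if "i \<in> {..<3}" "j \<in> {..<3}" "i \<noteq> j" for i j :: nat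
  proof -
    have "indep_var borel ((\<lambda>f. f i) \<circ> (\<lambda>\<omega>. restrict (\<lambda>i. ?X i \<omega>) {i}))
                    borel ((\<lambda>f. f j) \<circ> (\<lambda>\<omega>. restrict (\<lambda>i. ?X i \<omega>) {j}))"
      using that by (intro indep_var_compose[OF indep_var_restrict[OF ind]]) auto
    then show ?thesis by (simp add: comp_def)
  qed
  have UV: "indep_var borel U borel V" and VW: "indep_var borel V borel W"
    and UW: "indep_var borel U borel W"
    using pair[of 0 1] pair[of 1 2] pair[of 0 2] by simp_all
  show "distr M (borel \<Otimes>\<^sub>M borel) (\<lambda>\<omega>. (U \<omega>, V \<omega>)) = unif \<Otimes>\<^sub>M unif"
    using UV dU dV by (simp add: indep_var_distribution_eq)
  show "distr M (borel \<Otimes>\<^sub>M borel) (\<lambda>\<omega>. (V \<omega>, W \<omega>)) = unif \<Otimes>\<^sub>M unif"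
    using VW dV dW by (simp add: indep_var_distribution_eq)
  have dUW: "distr M (borel \<Otimes>\<^sub>M borel) (\<lambda>\<omega>. (U \<omega>, W \<omega>)) = unif \<Otimes>\<^sub>M unif"
    using UW dU dW by (simp add: indep_var_distribution_eq)
  \<comment> \<open>The middle variable and the two outer ones form independent blocks; the joint law of the
    blocks is then pushed forward along the coordinate projections.\<close>
  let ?A = "\<Pi>\<^sub>M i\<in>{1::nat}. (borel :: real measure)"
  let ?B = "\<Pi>\<^sub>M i\<in>{0, 2::nat}. (borel :: real measure)"
  let ?XA = "\<lambda>\<omega>. restrict (\<lambda>i. ?X i \<omega>) {1}"
  let ?XB = "\<lambda>\<omega>. restrict (\<lambda>i. ?X i \<omega>) {0, 2}"
  have "indep_var ?A ?XA ?B ?XB"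
    by (rule indep_var_restrict[OF ind]) auto
  then have XA [measurable]: "?XA \<in> M \<rightarrow>\<^sub>M ?A" and XB [measurable]: "?XB \<in> M \<rightarrow>\<^sub>M ?B"
    and joint: "distr M ?A ?XA \<Otimes>\<^sub>M distr M ?B ?XB = distr M (?A \<Otimes>\<^sub>M ?B) (\<lambda>\<omega>. (?XA \<omega>, ?XB \<omega>))"
    unfolding indep_var_distribution_eq by blast+
  have fA [measurable]: "(\<lambda>f. f 1) \<in> ?A \<rightarrow>\<^sub>M borel"
    by (rule measurable_component_singleton) simp
  have fB [measurable]: "(\<lambda>f. (f 0, f 2)) \<in> ?B \<rightarrow>\<^sub>M borel \<Otimes>\<^sub>M borel"
    by (intro measurable_Pair measurable_component_singleton) simp_all
  have V: "distr (distr M ?A ?XA) borel (\<lambda>f. f 1) = unif"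
    using dV by (subst distr_distr[OF fA XA]) (simp add: comp_def)
  have UW': "distr (distr M ?B ?XB) (borel \<Otimes>\<^sub>M borel) (\<lambda>f. (f 0, f 2)) = unif \<Otimes>\<^sub>M unif"
    using dUW by (subst distr_distr[OF fB XB]) (simp add: comp_def)
  have "unif \<Otimes>\<^sub>M (unif \<Otimes>\<^sub>M unif) = distr (distr M ?A ?XA) borel (\<lambda>f. f 1) \<Otimes>\<^sub>M
      distr (distr M ?B ?XB) (borel \<Otimes>\<^sub>M borel) (\<lambda>f. (f 0, f 2))"
    by (simp only: V UW')
  also have "\<dots> = distr (distr M ?A ?XA \<Otimes>\<^sub>M distr M ?B ?XB) (borel \<Otimes>\<^sub>M (borel \<Otimes>\<^sub>M borel))
      (\<lambda>(f, g). (f 1, (g 0, g 2)))"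
  proof (rule pair_measure_distr)
    show "sigma_finite_measure (distr (distr M ?B ?XB) (borel \<Otimes>\<^sub>M borel) (\<lambda>f. (f 0, f 2)))"
      unfolding UW' by unfold_locales
  qed (simp_all only: measurable_distr_eq1 fA fB)
  also have "\<dots> = distr M (borel \<Otimes>\<^sub>M (borel \<Otimes>\<^sub>M borel)) (\<lambda>\<omega>. (V \<omega>, (U \<omega>, W \<omega>)))"
  proof -
    have "(\<lambda>(f, g). (f 1, (g 0, g 2))) \<in> ?A \<Otimes>\<^sub>M ?B \<rightarrow>\<^sub>M borel \<Otimes>\<^sub>M (borel \<Otimes>\<^sub>M borel)"
      unfolding split_beta'
      by (intro measurable_Pair measurable_compose[OF measurable_fst fA]
            measurable_compose[OF measurable_snd] measurable_component_singleton) simp_all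
    then show ?thesis
      unfolding joint by (subst distr_distr) (use XA XB in \<open>auto simp: comp_def\<close>)
  qed
  finally show "distr M (borel \<Otimes>\<^sub>M (borel \<Otimes>\<^sub>M borel)) (\<lambda>\<omega>. (V \<omega>, (U \<omega>, W \<omega>))) = unif \<Otimes>\<^sub>M (unif \<Otimes>\<^sub>M unif)"
    by (rule sym)
qed

text \<open>Given \<open>v\<close>, the variables \<open>u\<close> and \<open>w\<close> are independent,
  and by symmetry \<open>h (u, v)\<close> and \<open>h (v, w)\<close> have the same conditional mean, so that
  the inner integral is a square.\<close>

lemma integral_chain_symmetric_nonneg:
  fixes h :: "real \<times> real \<Rightarrow> real"
  assumes h [measurable]: "h \<in> borel_measurable (borel \<Otimes>\<^sub>M borel)"
    and bound: "\<And>z. \<bar>h z\<bar> \<le> B" and sym: "\<And>x y. h (x, y) = h (y, x)"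
  shows "0 \<le> (\<integral>(v, (u, w)). h (u, v) * h (v, w) \<partial>(unif \<Otimes>\<^sub>M (unif \<Otimes>\<^sub>M unif)))"
proof -
  interpret T: pair_prob_space unif "unif \<Otimes>\<^sub>M unif" ..
  have meas: "(\<lambda>(v, (u, w)). h (u, v) * h (v, w)) \<in> borel_measurable (unif \<Otimes>\<^sub>M (unif \<Otimes>\<^sub>M unif))"
    unfolding split_beta' by measurable
  have bound2: "\<bar>h z * h z'\<bar> \<le> B * B" for z z'
    using bound[of z] bound[of z'] unfolding abs_mult by (intro mult_mono) auto
  have "integrable (unif \<Otimes>\<^sub>M (unif \<Otimes>\<^sub>M unif)) (\<lambda>(v, (u, w)). h (u, v) * h (v, w))"
    using meas bound2 by (intro T.P.integrable_const_bound[of _ "B * B"]) (auto simp: split_beta')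
  from T.integral_fst'[OF this]
  have "(\<integral>(v, (u, w)). h (u, v) * h (v, w) \<partial>(unif \<Otimes>\<^sub>M (unif \<Otimes>\<^sub>M unif))) =
      (\<integral>v. (\<integral>(u, w). h (u, v) * h (v, w) \<partial>(unif \<Otimes>\<^sub>M unif)) \<partial>unif)"
    by (simp add: split_beta')
  also have "\<dots> = (\<integral>v. (\<integral>u. h (u, v) \<partial>unif)\<^sup>2 \<partial>unif)"
  proof (rule Bochner_Integration.integral_cong[OF refl])
    fix v :: real
    have "(\<lambda>(u, w). h (u, v) * h (v, w)) \<in> borel_measurable (unif \<Otimes>\<^sub>M unif)"
      unfolding split_beta' by measurable
    then have "integrable (unif \<Otimes>\<^sub>M unif) (\<lambda>(u, w). h (u, v) * h (v, w))"
      using bound2 by (intro unif2.P.integrable_const_bound[of _ "B * B"]) (auto simp: split_beta')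
    from unif2.integral_fst'[OF this]
    have "(\<integral>(u, w). h (u, v) * h (v, w) \<partial>(unif \<Otimes>\<^sub>M unif)) =
        (\<integral>u. (\<integral>w. h (u, v) * h (v, w) \<partial>unif) \<partial>unif)"
      by simp
    also have "\<dots> = (\<integral>u. h (u, v) \<partial>unif) * (\<integral>w. h (v, w) \<partial>unif)"
      by simp
    also have "(\<integral>w. h (v, w) \<partial>unif) = (\<integral>u. h (u, v) \<partial>unif)"
      using sym by simp
    finally show "(\<integral>(u, w). h (u, v) * h (v, w) \<partial>(unif \<Otimes>\<^sub>M unif)) = (\<integral>u. h (u, v) \<partial>unif)\<^sup>2"
      by (simp add: power2_eq_square)
  qed
  also have "\<dots> \<ge> 0" by simp
  finally show ?thesis .
qed

theorem proposition2p17: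
  fixes p\<^sub>1 p\<^sub>2 :: real and r :: nat and \<pi> :: "nat \<Rightarrow> nat"
    and M :: "'a measure" and U V W :: "'a \<Rightarrow> real"
  assumes "p\<^sub>1 \<in> {0..1}" and "p\<^sub>2 \<in> {0..1}" and "p\<^sub>1 + p\<^sub>2 \<le> 1"
    and "r \<ge> 2" and "\<pi> permutes {1..r}"
    and "prob_space M" and "iid_uniform3 M U V W"
    and "p\<^sub>1 < 1" and "\<pi> = inv \<pi>"
  shows "\<Sigma>\<^sub>d M U V W r p\<^sub>1 p\<^sub>2 \<pi> > 0"
proof -
  interpret prob_space M by fact
  define f where "f = \<psi> r p\<^sub>1 \<pi>"
  have p: "0 \<le> p\<^sub>1" "p\<^sub>1 \<le> 1" and r: "r \<ge> 1" using assms by auto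
  have f [measurable]: "f \<in> borel_measurable (borel \<Otimes>\<^sub>M borel)"
    unfolding f_def borel_prod by (rule measurable_\<psi>[OF p r assms(5)])
  have f01: "0 \<le> f z" "f z \<le> 1" for z
    unfolding f_def by (rule \<psi>_nonneg, rule \<psi>_le_1[OF p])
  have sym: "f (x, y) = f (y, x)" for x y
    using \<psi>_swap[OF p r assms(5), of "(y, x)"] assms(9) by (simp add: f_def)
  have rv [measurable]: "U \<in> borel_measurable M" "V \<in> borel_measurable M" "W \<in> borel_measurable M"
  proof -
    have "indep_vars (\<lambda>_. borel) (\<lambda>i. [U, V, W] ! i) {..<3}"
      using assms(7) by (simp add: iid_uniform3_def)
    then have "random_variable borel ([U, V, W] ! i)" if "i < 3" for i
      using that by (auto simp: indep_vars_def)
    from this[of 0] this[of 1] this[of 2]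
    show "U \<in> borel_measurable M" "V \<in> borel_measurable M" "W \<in> borel_measurable M" by simp_all
  qed
  note distrs = iid_uniform3_distr[OF assms(6,7)]
  define c where "c = (\<integral>z. f z \<partial>(unif \<Otimes>\<^sub>M unif))"
  have EUV: "expectation (\<lambda>\<omega>. f (U \<omega>, V \<omega>)) = c"
    unfolding c_def distrs(1)[symmetric] by (subst integral_distr) simp_all
  have EVW: "expectation (\<lambda>\<omega>. f (V \<omega>, W \<omega>)) = c"
    unfolding c_def distrs(2)[symmetric] by (subst integral_distr) simp_all
  define h where "h z = f z - c" for z
  have h [measurable]: "h \<in> borel_measurable (borel \<Otimes>\<^sub>M borel)"
    unfolding h_def by measurable
  have c01: "0 \<le> c" "c \<le> 1"
    unfolding EUV[symmetric] using f01
    by (auto intro!: integral_nonneg integral_le_const integrable_const_bound[of _ 1])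
  then have h_bound: "\<bar>h z\<bar> \<le> 1" for z using f01[of z] by (simp add: h_def abs_le_iff)
  have "covariance M (\<lambda>\<omega>. f (U \<omega>, V \<omega>)) (\<lambda>\<omega>. f (V \<omega>, W \<omega>)) =
      expectation (\<lambda>\<omega>. (\<lambda>(v, (u, w)). h (u, v) * h (v, w)) (V \<omega>, (U \<omega>, W \<omega>)))"
    by (simp add: covariance_def EUV EVW h_def)
  also have "\<dots> = (\<integral>(v, (u, w)). h (u, v) * h (v, w) \<partial>(unif \<Otimes>\<^sub>M (unif \<Otimes>\<^sub>M unif)))"
    unfolding distrs(3)[symmetric] by (subst integral_distr) (simp_all add: split_beta')
  also have "\<dots> \<ge> 0"
    by (rule integral_chain_symmetric_nonneg[OF h h_bound]) (simp add: h_def sym)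
  finally have cov_chain: "covariance M (\<lambda>\<omega>. f (U \<omega>, V \<omega>)) (\<lambda>\<omega>. f (V \<omega>, W \<omega>)) \<ge> 0" .
  have cov_swap: "covariance M (\<lambda>\<omega>. f (U \<omega>, V \<omega>)) (\<lambda>\<omega>. f (V \<omega>, U \<omega>)) =
      variance (\<lambda>\<omega>. f (U \<omega>, V \<omega>))"
    unfolding covariance_def sym[of "V _" "U _"] power2_eq_square ..
  have var_eq: "variance (\<lambda>\<omega>. f (U \<omega>, V \<omega>)) = (\<integral>z. (h z)\<^sup>2 \<partial>(unif \<Otimes>\<^sub>M unif))"
    unfolding EUV distrs(1)[symmetric] by (subst integral_distr) (simp_all add: h_def)
  have "(\<integral>z. (h z)\<^sup>2 \<partial>(unif \<Otimes>\<^sub>M unif)) \<noteq> 0"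
  proof
    assume 0: "(\<integral>z. (h z)\<^sup>2 \<partial>(unif \<Otimes>\<^sub>M unif)) = 0"
    have "(\<lambda>z. (h z)\<^sup>2) \<in> borel_measurable (borel \<Otimes>\<^sub>M borel)"
      by measurable
    then have "(\<lambda>z. (h z)\<^sup>2) \<in> borel_measurable (unif \<Otimes>\<^sub>M unif)"
      unfolding borel_prod by (simp cong: measurable_cong_sets)
    then have "integrable (unif \<Otimes>\<^sub>M unif) (\<lambda>z. (h z)\<^sup>2)"
      using h_bound
      by (intro unif2.P.integrable_const_bound[of _ 1]) (auto simp: abs_square_le_1)
    with 0 have "AE z in unif \<Otimes>\<^sub>M unif. (h z)\<^sup>2 = 0"
      by (subst (asm) integral_nonneg_eq_0_iff_AE) auto
    then have "AE z in unif \<Otimes>\<^sub>M unif. \<psi> r p\<^sub>1 \<pi> z = c"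
      by (simp add: h_def f_def)
    with \<psi>_not_AE_const[OF p(1) assms(8,4,5)] show False by blast
  qed
  moreover have "(\<integral>z. (h z)\<^sup>2 \<partial>(unif \<Otimes>\<^sub>M unif)) \<ge> 0" by simp
  ultimately have var_pos: "variance (\<lambda>\<omega>. f (U \<omega>, V \<omega>)) > 0"
    unfolding var_eq by linarith
  have "p\<^sub>1 * variance (\<lambda>\<omega>. f (U \<omega>, U \<omega>)) \<ge> 0"
    using p by (intro mult_nonneg_nonneg variance_positive)
  moreover have "(1 - p\<^sub>1) * variance (\<lambda>\<omega>. f (U \<omega>, V \<omega>)) > 0"
    using var_pos assms(8) by simp
  moreover have "p\<^sub>2 * covariance M (\<lambda>\<omega>. f (U \<omega>, V \<omega>)) (\<lambda>\<omega>. f (V \<omega>, U \<omega>)) \<ge> 0"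
    using var_pos assms(2) unfolding cov_swap by simp
  moreover have "2 * (1 - p\<^sub>1 - p\<^sub>2) *
      covariance M (\<lambda>\<omega>. f (U \<omega>, V \<omega>)) (\<lambda>\<omega>. f (V \<omega>, W \<omega>)) \<ge> 0"
    using cov_chain assms(3) by simp
  ultimately show ?thesis
    unfolding \<Sigma>\<^sub>d_def f_def[symmetric] 
    by (intro divide_pos_pos add_pos_nonneg[OF add_pos_nonneg[OF add_nonneg_pos]]) simp_all
qed

end
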